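(* Let $K:\mathbb{R}^m_{\ge0}\to\mathbb{S}^n_{\succeq0}$ be continuous with $K(x)\succ0$ for every $x\in\mathbb{R}^m_{>0}$, let $Q\in\mathbb{R}^{n\times d}$ be a nonzero matrix, let $l\in\mathbb{R}^m$ have positive components, and let $V_0>0$. Define, for $x\in\mathbb{R}^m_{\ge0}$ and $\epsilon>0$, $$\psi(x):=\lambda_{\max}(QQ^\top,K(x)),\qquad \psi^\epsilon(x):=\lambda_{\max}(QQ^\top,K(x)+\epsilon I).$$ For each $\epsilon>0$ let $x^\epsilon$ be an optimal solution of $$\min_{x\in\mathbb{R}^m_{\ge0}}\ \psi^\epsilon(x)\quad\text{subject to}\quad l^\top x\le V_0.$$ Then $\lim_{\epsilon\to0}\psi^\epsilon(x^\epsilon)=\psi(x^* )$, where $x^*$ is an optimal solution of $$\min_{x\in\mathbb{R}^m_{\ge0}}\ \psi(x)\quad\text{subject to}\quad l^\top x\le V_0,$$ and any limit point of $\{x^\epsilon\}$ as $\epsilon\to0$ is an optimal solution of the latter problem.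
   Context: $\mathbb{R}^m_{\ge0}$ and $\mathbb{R}^m_{>0}$ are the sets of vectors in $\mathbb{R}^m$ with nonnegative, respectively positive, components; $\mathbb{S}^n_{\succeq0}$ is the set of real symmetric positive semidefinite $n\times n$ matrices; $\mathrm{Ker}\,Y=\{v\in\mathbb{R}^n\mid Yv=0\}$. For $X,Y\in\mathbb{S}^n_{\succeq0}$, $$\lambda_{\max}(X,Y):=\begin{cases}\displaystyle\sup_{v\notin\mathrm{Ker}\,Y}\frac{v^\top Xv}{v^\top Yv} & (Y\neq0),\\ \infty & (X\neq0,\ Y=0),\\ 0 & (X=Y=0).\end{cases}$$ A limit point of $\{x^\epsilon\}$ as $\epsilon\to0$ is a point $\bar x$ such that $x^{\epsilon_k}\to\bar x$ for some sequence $\epsilon_k>0$ with $\epsilon_k\to0$. *)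

theory Defs
  imports "HOL-Analysis.Analysis"
begin

definition nonneg_orthant :: "(real ^ 'm) set" where
  "nonneg_orthant = {x. \<forall>i. 0 \<le> x $ i}"

definition pos_orthant :: "(real ^ 'm) set" where
  "pos_orthant = {x. \<forall>i. 0 < x $ i}"

definition psd :: "real ^ 'n ^ 'n \<Rightarrow> bool" where
  "psd A \<longleftrightarrow> transpose A = A \<and> (\<forall>v. 0 \<le> v \<bullet> (A *v v))"

definition pd :: "real ^ 'n ^ 'n \<Rightarrow> bool" where
  "pd A \<longleftrightarrow> transpose A = A \<and> (\<forall>v. v \<noteq> 0 \<longrightarrow> 0 < v \<bullet> (A *v v))"

definition Ker :: "real ^ 'n ^ 'n \<Rightarrow> (real ^ 'n) set" where
  "Ker Y = {v. Y *v v = 0}"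

(* Meaningful for psd X and Y only: then v \<notin> Ker Y forces a positive denominator.
   Extended-real values: the supremum is \<infinity> when Ker Y is not contained in Ker X. *)
definition lambda_max :: "real ^ 'n ^ 'n \<Rightarrow> real ^ 'n ^ 'n \<Rightarrow> ereal" where
  "lambda_max X Y =
     (if Y \<noteq> 0 then (SUP v \<in> - Ker Y. ereal ((v \<bullet> (X *v v)) / (v \<bullet> (Y *v v))))
      else if X \<noteq> 0 then \<infinity>
      else 0)"

definition psi :: "(real ^ 'm \<Rightarrow> real ^ 'n ^ 'n) \<Rightarrow> real ^ 'd ^ 'n \<Rightarrow> real ^ 'm \<Rightarrow> ereal" where
  "psi K Q x = lambda_max (Q ** transpose Q) (K x)"

definition psi_eps ::
  "(real ^ 'm \<Rightarrow> real ^ 'n ^ 'n) \<Rightarrow> real ^ 'd ^ 'n \<Rightarrow> real \<Rightarrow> real ^ 'm \<Rightarrow> ereal" where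
  "psi_eps K Q \<epsilon> x = lambda_max (Q ** transpose Q) (K x + \<epsilon> *\<^sub>R mat 1)"

definition feasible :: "real ^ 'm \<Rightarrow> real \<Rightarrow> real ^ 'm \<Rightarrow> bool" where
  "feasible l V0 x \<longleftrightarrow> x \<in> nonneg_orthant \<and> l \<bullet> x \<le> V0"

definition limit_point_at_0 :: "(real \<Rightarrow> real ^ 'm) \<Rightarrow> real ^ 'm \<Rightarrow> bool" where
  "limit_point_at_0 x xbar \<longleftrightarrow>
     (\<exists>e :: nat \<Rightarrow> real. (\<forall>k. 0 < e k) \<and> e \<longlonglongrightarrow> 0 \<and> (\<lambda>k. x (e k)) \<longlonglongrightarrow> xbar)"

end

theory Submission
  imports Defs
begin

text \<open>For psd \<open>X \<noteq> 0\<close> and \<open>Y\<close>, one has \<open>\<lambda>\<^sub>m\<^sub>a\<^sub>x(X, Y) \<le> t\<close> iff \<open>t Y - X\<close> is positive semidefinite, so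
  sublevel conditions are families of weak inequalities that are continuous in \<open>Y\<close> and
  monotone in \<open>\<epsilon>\<close>. Hence \<open>\<psi>\<^sup>\<epsilon> \<le> \<psi>\<close>, and any bound on \<open>\<psi>\<^sup>\<epsilon>(x\<^sup>\<epsilon>)\<close> along a sequence passes
  to \<open>\<psi>\<close> at a limit of the \<open>x\<^sup>\<epsilon>\<close>. Since \<open>\<psi>\<^sup>\<epsilon>(x\<^sup>\<epsilon>) \<le> \<psi>\<^sup>\<epsilon>(y) \<le> \<psi>(y)\<close> for every feasible \<open>y\<close>, limit
  points are optimal; compactness of the feasible set yields the rest.\<close>

section \<open>Quadratic forms along lines\<close>

lemma quadratic_form_add_scaleR:
  fixes A :: "real ^ 'n ^ 'n"
  assumes "transpose A = A"
  shows "(w + s *\<^sub>R v) \<bullet> (A *v (w + s *\<^sub>R v)) =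
    w \<bullet> (A *v w) + 2 * s * (w \<bullet> (A *v v)) + s\<^sup>2 * (v \<bullet> (A *v v))"
proof -
  have "v \<bullet> (A *v w) = w \<bullet> (A *v v)"
    by (metis assms dot_lmul_matrix inner_commute transpose_matrix_vector)
  then show ?thesis
    by (simp add: matrix_vector_mult_add_rdistrib matrix_vector_right_distrib
        matrix_vector_mult_scaleR inner_add_left inner_add_right power2_eq_square algebra_simps)
qed

text \<open>A positive leading coefficient would make the quadratic exceed any constant for large
  \<open>s\<close>. It serves to treat kernel vectors in
  \<open>lambda_max_le_ereal_iff\<close>.\<close>

lemma quadratic_bounded_above_imp_nonpos:
  fixes a b c :: real
  assumes "\<And>s. b * s + a * s\<^sup>2 \<le> c"
  shows "a \<le> 0"
proof (rule ccontr)
  assume "\<not> a \<le> 0"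
  then have a: "a > 0" by simp
  \<comment> \<open>The quotient makes \<open>b + a * s\<close> at least
    \<open>\<bar>c\<bar> + 1\<close>; the extra 1 gives \<open>s \<ge> 1\<close>, so multiplying by
    \<open>s\<close> keeps this bound.\<close>
  define s where "s = (\<bar>b\<bar> + \<bar>c\<bar> + 1) / a + 1"
  have s1: "s \<ge> 1" using a by (simp add: s_def)
  have "a * s = \<bar>b\<bar> + \<bar>c\<bar> + 1 + a" using a by (simp add: s_def field_simps)
  then have "b + a * s \<ge> \<bar>c\<bar> + 1" using a by linarith
  then have "(b + a * s) * s \<ge> (\<bar>c\<bar> + 1) * 1"
    using s1 by (intro mult_mono) auto
  moreover have "(b + a * s) * s = b * s + a * s\<^sup>2"
    by (simp add: power2_eq_square algebra_simps)
  ultimately show False using assms[of s] abs_ge_self[of c] by simp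
qed

text \<open>Along the line \<open>u + s *\<^sub>R v\<close> with \<open>u = A *v v\<close> the form
  has no quadratic term, so it is affine in \<open>s\<close> with slope
  \<open>2 * (u \<bullet> u)\<close>. Being nonnegative for all \<open>s\<close>, it must have slope
  zero.\<close>

lemma psd_quadratic_form_eq_0:
  assumes "psd A" and "v \<bullet> (A *v v) = 0"
  shows "A *v v = 0"
proof -
  have sym: "transpose A = A" and nonneg: "\<And>u. 0 \<le> u \<bullet> (A *v u)"
    using assms(1) by (auto simp: psd_def)
  define u where "u = A *v v"
  have lin: "0 \<le> u \<bullet> (A *v u) + 2 * s * (u \<bullet> u)" for s
    using nonneg[of "u + s *\<^sub>R v"] assms(2)
    by (simp add: quadratic_form_add_scaleR[OF sym] u_def)
  have "u \<bullet> u = 0"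
  proof (rule ccontr)
    assume "u \<bullet> u \<noteq> 0"
    then show False
      \<comment> \<open>At this \<open>s\<close> the affine expression equals -1.\<close>
      using lin[of "- (u \<bullet> (A *v u) + 1) / (2 * (u \<bullet> u))"]
      by (simp add: field_split_simps del: inner_eq_zero_iff)
  qed
  then show ?thesis by (simp add: u_def)
qed

section \<open>Sublevel sets of the generalized eigenvalue\<close>

lemma matrix_eq_0_iff:
  fixes A :: "real ^ 'n ^ 'm"
  shows "A = 0 \<longleftrightarrow> (\<forall>v. A *v v = 0)"
  by (metis matrix_eq matrix_vector_mult_0)

text \<open>Off \<open>Ker Y\<close> one clears a positive denominator. The supremum ignores kernel
  vectors, yet the bound extends to them because the complement of the kernel is stable under adding
  them. With \<open>X = Y = 0\<close> the equivalence would fail for negative \<open>t\<close>,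
  hence \<open>X \<noteq> 0\<close>.\<close>

lemma lambda_max_le_ereal_iff:
  assumes X: "psd X" "X \<noteq> 0" and Y: "psd Y"
  shows "lambda_max X Y \<le> ereal t \<longleftrightarrow> (\<forall>v. v \<bullet> (X *v v) \<le> t * (v \<bullet> (Y *v v)))"
proof (cases "Y = 0")
  \<comment> \<open>Both sides are false: the value is infinite, and the form of \<open>X\<close> is
    positive somewhere.\<close>
  case True
  obtain v where "X *v v \<noteq> 0"
    using X(2) matrix_eq_0_iff by blast
  then have "v \<bullet> (X *v v) > 0"
    using psd_quadratic_form_eq_0[OF X(1)] X(1) by (force simp: psd_def order_less_le)
  then show ?thesis
    using True X(2) by (auto simp: lambda_max_def not_le)
next
  case False
  have symX: "transpose X = X" and symY: "transpose Y = Y"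
    using X Y by (auto simp: psd_def)
  have pos: "v \<bullet> (Y *v v) > 0" if "v \<notin> Ker Y" for v
    using that psd_quadratic_form_eq_0[OF Y] Y by (force simp: psd_def Ker_def order_less_le)
  have "lambda_max X Y \<le> ereal t \<longleftrightarrow> (\<forall>v\<in>- Ker Y. v \<bullet> (X *v v) / (v \<bullet> (Y *v v)) \<le> t)"
    using False by (simp add: lambda_max_def SUP_le_iff)
  also have "\<dots> \<longleftrightarrow> (\<forall>v\<in>- Ker Y. v \<bullet> (X *v v) \<le> t * (v \<bullet> (Y *v v)))"
    using pos by (auto simp: pos_divide_le_eq)
  also have "\<dots> \<longleftrightarrow> (\<forall>v. v \<bullet> (X *v v) \<le> t * (v \<bullet> (Y *v v)))"
  proof (intro iffI allI)
    fix v
    assume le: "\<forall>v\<in>- Ker Y. v \<bullet> (X *v v) \<le> t * (v \<bullet> (Y *v v))"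
    show "v \<bullet> (X *v v) \<le> t * (v \<bullet> (Y *v v))"
    proof (cases "v \<in> Ker Y")
      case True
      then have Yv: "Y *v v = 0" by (simp add: Ker_def)
      obtain w where w: "Y *v w \<noteq> 0"
        using False matrix_eq_0_iff by blast
      txt \<open>On the line \<open>w + s v\<close> the form of \<open>Y\<close> is constant, so that of \<open>X\<close> is bounded.\<close>
      have "w + s *\<^sub>R v \<in> - Ker Y" for s
        using w Yv by (simp add: Ker_def matrix_vector_right_distrib matrix_vector_mult_scaleR)
      from le[rule_format, OF this]
      have "2 * (w \<bullet> (X *v v)) * s + (v \<bullet> (X *v v)) * s\<^sup>2
          \<le> t * (w \<bullet> (Y *v w)) - w \<bullet> (X *v w)" for s
        unfolding quadratic_form_add_scaleR[OF symX] quadratic_form_add_scaleR[OF symY] Yv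
        by (simp add: algebra_simps)
      from quadratic_bounded_above_imp_nonpos[OF this] show ?thesis
        by (simp add: Yv)
    qed (use le in auto)
  qed auto
  finally show ?thesis .
qed

section \<open>The matrices entering the two objectives\<close>

lemma quadratic_form_mult_transpose:
  fixes Q :: "real ^ 'd ^ 'n"
  shows "v \<bullet> ((Q ** transpose Q) *v v) = (transpose Q *v v) \<bullet> (transpose Q *v v)"
  by (metis dot_lmul_matrix matrix_vector_mul_assoc transpose_matrix_vector)

lemma psd_mult_transpose:
  fixes Q :: "real ^ 'd ^ 'n"
  shows "psd (Q ** transpose Q)"
  unfolding psd_def quadratic_form_mult_transpose by (simp add: matrix_transpose_mul)

lemma mult_transpose_eq_0_iff:
  fixes Q :: "real ^ 'd ^ 'n"
  shows "Q ** transpose Q = 0 \<longleftrightarrow> Q = 0"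
proof
  assume "Q ** transpose Q = 0"
  then have "(transpose Q *v v) \<bullet> (transpose Q *v v) = 0" for v
    unfolding quadratic_form_mult_transpose[symmetric] by simp
  then have "transpose Q = 0"
    by (simp add: matrix_eq_0_iff)
  then show "Q = 0"
    by (metis matrix_eq_0_iff transpose_matrix_vector transpose_transpose vector_matrix_mult_0_right)
qed simp

lemma quadratic_form_add_mat:
  fixes A :: "real ^ 'n ^ 'n"
  shows "v \<bullet> ((A + \<epsilon> *\<^sub>R mat 1) *v v) = v \<bullet> (A *v v) + \<epsilon> * (v \<bullet> v)"
  by (simp add: matrix_vector_mult_add_rdistrib scaleR_matrix_vector_assoc[symmetric] inner_add_right)

lemma psd_add_mat:
  assumes "psd A" "\<epsilon> \<ge> 0"
  shows "psd (A + \<epsilon> *\<^sub>R mat 1)"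
  unfolding psd_def quadratic_form_add_mat
proof
  have "transpose (A + \<epsilon> *\<^sub>R mat 1) = transpose A + \<epsilon> *\<^sub>R transpose (mat 1)"
    by (simp add: transpose_def vec_eq_iff)
  then show "transpose (A + \<epsilon> *\<^sub>R mat 1) = A + \<epsilon> *\<^sub>R mat 1"
    using assms by (simp add: psd_def transpose_mat)
qed (use assms in \<open>auto simp: psd_def\<close>)

section \<open>Comparison and semicontinuity of the objectives\<close>

lemma psi_eps_le_ereal_iff:
  assumes "Q \<noteq> 0" "psd (K y)" "\<epsilon> \<ge> 0"
  shows "psi_eps K Q \<epsilon> y \<le> ereal t \<longleftrightarrow>
    (\<forall>v. v \<bullet> ((Q ** transpose Q) *v v) \<le> t * (v \<bullet> (K y *v v) + \<epsilon> * (v \<bullet> v)))"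
  unfolding psi_eps_def
  using lambda_max_le_ereal_iff[OF psd_mult_transpose _ psd_add_mat] assms
  by (simp add: mult_transpose_eq_0_iff quadratic_form_add_mat)

text \<open>Treating \<open>psi\<close> as the case of parameter 0 lets one criterion, stated for
  \<open>\<epsilon> \<ge> 0\<close>, cover both objectives.\<close>

lemma psi_eps_0: "psi_eps K Q 0 = psi K Q"
  by (simp add: psi_eps_def psi_def fun_eq_iff)

lemmas psi_le_ereal_iff = psi_eps_le_ereal_iff[where \<epsilon> = 0, unfolded psi_eps_0, simplified]

text \<open>Reduces comparisons of possibly infinite values to real thresholds, where the quadratic
  form criterion applies; for \<open>b = \<infinity>\<close> the premise is vacuous.\<close>

lemma ereal_le_if_real_upper_bounds:
  fixes a b :: ereal
  assumes "\<And>t. b \<le> ereal t \<Longrightarrow> a \<le> ereal t"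
  shows "a \<le> b"
proof (rule ccontr)
  assume "\<not> a \<le> b"
  then obtain t where "b < ereal t" "ereal t < a"
    using ereal_dense2[of b a] by (auto simp: not_le)
  with assms[of t] show False by (simp add: not_le[symmetric])
qed

lemma psi_eps_le_psi:
  assumes "Q \<noteq> 0" "psd (K y)" "\<epsilon> > 0"
  shows "psi_eps K Q \<epsilon> y \<le> psi K Q y"
proof (rule ereal_le_if_real_upper_bounds)
  fix t
  assume "psi K Q y \<le> ereal t"
  then have le: "v \<bullet> ((Q ** transpose Q) *v v) \<le> t * (v \<bullet> (K y *v v))" for v
    using assms by (simp add: psi_le_ereal_iff)
  \<comment> \<open>The sign matters: for negative \<open>t\<close>, adding
    \<open>\<epsilon> * (v \<bullet> v)\<close> would lower the right-hand side. It follows from a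
    vector on which the form of the nonzero matrix \<open>Q ** transpose Q\<close> is
    positive.\<close>
  have "t \<ge> 0"
  proof -
    obtain v where v: "(Q ** transpose Q) *v v \<noteq> 0"
      using assms(1) matrix_eq_0_iff mult_transpose_eq_0_iff by blast
    then have "v \<bullet> ((Q ** transpose Q) *v v) > 0"
      using psd_quadratic_form_eq_0[OF psd_mult_transpose] psd_mult_transpose[of Q]
      by (force simp: psd_def order_less_le)
    with le[of v] have "0 < t * (v \<bullet> (K y *v v))" by simp
    with assms(2) show ?thesis
      using mult_nonpos_nonneg[of t "v \<bullet> (K y *v v)"] by (force simp: psd_def)
  qed
  then have "t * (v \<bullet> (K y *v v)) \<le> t * (v \<bullet> (K y *v v) + \<epsilon> * (v \<bullet> v))" for v
    using assms(3) by (intro mult_left_mono) auto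
  with le show "psi_eps K Q \<epsilon> y \<le> ereal t"
    using assms by (subst psi_eps_le_ereal_iff) (auto intro: order_trans)
qed

text \<open>Lower semicontinuity, jointly in the parameter and the point: for each fixed
  \<open>v\<close> the criterion is a weak inequality between convergent sequences.\<close>

lemma psi_le_of_psi_eps_le:
  assumes K_cont: "continuous_on nonneg_orthant K"
    and K_psd: "\<And>y. y \<in> nonneg_orthant \<Longrightarrow> psd (K y)"
    and Q: "Q \<noteq> 0"
    and e: "\<And>k. e k \<ge> 0" "e \<longlonglongrightarrow> 0"
    and y: "\<And>k. y k \<in> nonneg_orthant" "y \<longlonglongrightarrow> ybar" "ybar \<in> nonneg_orthant"
    and le: "\<And>k. psi_eps K Q (e k) (y k) \<le> ereal t"
  shows "psi K Q ybar \<le> ereal t"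
proof -
  have Ky: "(\<lambda>k. K (y k)) \<longlonglongrightarrow> K ybar"
    using K_cont y unfolding continuous_on_sequentially by (auto simp: comp_def)
  have "v \<bullet> ((Q ** transpose Q) *v v) \<le> t * (v \<bullet> (K ybar *v v))" for v
  proof (rule LIMSEQ_le_const)
    have "(\<lambda>k. K (y k) *v v) \<longlonglongrightarrow> K ybar *v v"
      unfolding matrix_vector_mult_def
      by (intro vec_tendstoI) (simp add: tendsto_sum tendsto_mult tendsto_vec_nth Ky)
    then have "(\<lambda>k. t * (v \<bullet> (K (y k) *v v) + e k * (v \<bullet> v)))
        \<longlonglongrightarrow> t * (v \<bullet> (K ybar *v v) + 0 * (v \<bullet> v))"
      by (intro tendsto_intros e)
    then show "(\<lambda>k. t * (v \<bullet> (K (y k) *v v) + e k * (v \<bullet> v)))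
        \<longlonglongrightarrow> t * (v \<bullet> (K ybar *v v))"
      by simp
    show "\<exists>N. \<forall>k\<ge>N. v \<bullet> ((Q ** transpose Q) *v v)
        \<le> t * (v \<bullet> (K (y k) *v v) + e k * (v \<bullet> v))"
      using le by (simp add: psi_eps_le_ereal_iff Q K_psd y(1) e(1))
  qed
  then show ?thesis
    by (simp add: psi_le_ereal_iff Q K_psd y(3))
qed

section \<open>Compactness of the feasible set\<close>

lemma compact_feasible:
  assumes "l \<in> pos_orthant"
  shows "compact (Collect (feasible l V0))"
proof -
  have "Collect (feasible l V0) = {x. \<forall>i. 0 \<le> x $ i} \<inter> {x. l \<bullet> x \<le> V0}"
    by (auto simp: feasible_def nonneg_orthant_def)
  moreover have "closed {x::real^'a. \<forall>i. 0 \<le> x $ i}"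
    by (intro closed_Collect_all closed_Collect_le continuous_intros)
  moreover have "closed {x. l \<bullet> x \<le> V0}"
    by (intro closed_Collect_le continuous_intros)
  ultimately have "closed (Collect (feasible l V0))" by auto
  \<comment> \<open>All terms of \<open>l \<bullet> x\<close> are nonnegative, so each is at most
    \<open>V0\<close>; dividing by \<open>l $ i > 0\<close> bounds the coordinate.\<close>
  moreover have "Collect (feasible l V0) \<subseteq> cbox 0 (\<chi> i. V0 / l $ i)"
  proof
    fix x
    assume "x \<in> Collect (feasible l V0)"
    then have x: "\<And>i. 0 \<le> x $ i" "l \<bullet> x \<le> V0"
      by (auto simp: feasible_def nonneg_orthant_def)
    have l: "0 < l $ i" for i
      using assms by (simp add: pos_orthant_def)
    have "l $ i * x $ i \<le> V0" for i
    proof -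
      have "l $ i * x $ i \<le> (\<Sum>j\<in>UNIV. l $ j * x $ j)"
        by (rule member_le_sum) (auto intro!: mult_nonneg_nonneg x less_imp_le[OF l])
      with x(2) show ?thesis by (simp add: inner_vec_def)
    qed
    then show "x \<in> cbox 0 (\<chi> i. V0 / l $ i)"
      using x l by (simp add: mem_box_cart pos_le_divide_eq mult.commute)
  qed
  then have "bounded (Collect (feasible l V0))"
    using bounded_subset bounded_cbox by blast
  ultimately show ?thesis by (simp add: compact_eq_bounded_closed)
qed

section \<open>Convergence of optimal values and optimal solutions\<close>

theorem corollary11:
  fixes K :: "real ^ 'm \<Rightarrow> real ^ 'n ^ 'n"
    and Q :: "real ^ 'd ^ 'n"
    and l :: "real ^ 'm"
    and V0 :: real
    and x :: "real \<Rightarrow> real ^ 'm"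
  assumes K_cont: "continuous_on nonneg_orthant K"
    and K_psd: "\<And>y. y \<in> nonneg_orthant \<Longrightarrow> psd (K y)"
    and K_pd: "\<And>y. y \<in> pos_orthant \<Longrightarrow> pd (K y)"
    and Q_nz: "Q \<noteq> 0"
    and l_pos: "l \<in> pos_orthant"
    and V0_pos: "V0 > 0"
    and x_opt: "\<And>\<epsilon>. \<epsilon> > 0 \<Longrightarrow> is_arg_min (psi_eps K Q \<epsilon>) (feasible l V0) (x \<epsilon>)"
  shows "(\<exists>xstar. is_arg_min (psi K Q) (feasible l V0) xstar)
    \<and> (\<forall>xstar. is_arg_min (psi K Q) (feasible l V0) xstar \<longrightarrow>
          ((\<lambda>\<epsilon>. psi_eps K Q \<epsilon> (x \<epsilon>)) \<longlongrightarrow> psi K Q xstar) (at_right 0))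
    \<and> (\<forall>xbar. limit_point_at_0 x xbar \<longrightarrow> is_arg_min (psi K Q) (feasible l V0) xbar)"
proof -
  have feas_nonneg: "y \<in> nonneg_orthant" if "feasible l V0 y" for y
    using that by (simp add: feasible_def)
  have x_feas: "feasible l V0 (x \<epsilon>)" if "\<epsilon> > 0" for \<epsilon>
    using x_opt[OF that] by (simp add: is_arg_min_def)
  have x_le: "psi_eps K Q \<epsilon> (x \<epsilon>) \<le> psi K Q y" if "\<epsilon> > 0" "feasible l V0 y" for \<epsilon> y
  proof -
    have "psi_eps K Q \<epsilon> (x \<epsilon>) \<le> psi_eps K Q \<epsilon> y"
      using x_opt[OF that(1)] that(2) by (auto simp: is_arg_min_def not_less)
    also have "\<dots> \<le> psi K Q y"
      using that Q_nz K_psd feas_nonneg by (intro psi_eps_le_psi) auto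
    finally show ?thesis .
  qed
  have limit_feas: "feasible l V0 xbar"
    if "\<And>k. 0 < e k" "(\<lambda>k. x (e k)) \<longlonglongrightarrow> xbar" for xbar and e :: "nat \<Rightarrow> real"
    using closed_sequentially[of "Collect (feasible l V0)" "\<lambda>k. x (e k)" xbar] that
      compact_imp_closed[OF compact_feasible[OF l_pos]] x_feas by simp
  \<comment> \<open>Applied twice below: with \<open>t\<close> above the value at a feasible
    competitor, and with \<open>t\<close> below the optimal value to reach a contradiction.\<close>
  have limit_le: "psi K Q xbar \<le> ereal t"
    if "\<And>k. 0 < e k" "e \<longlonglongrightarrow> 0" "(\<lambda>k. x (e k)) \<longlonglongrightarrow> xbar"
      "\<And>k. psi_eps K Q (e k) (x (e k)) \<le> ereal t" for xbar t and e :: "nat \<Rightarrow> real"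
  proof (rule psi_le_of_psi_eps_le[where y = "\<lambda>k. x (e k)" and e = e, OF K_cont K_psd Q_nz])
    show "xbar \<in> nonneg_orthant"
      using limit_feas[of e] that(1,3) feas_nonneg by blast
    show "x (e k) \<in> nonneg_orthant" for k
      using x_feas that(1) feas_nonneg by blast
  qed (use that in \<open>auto intro: less_imp_le\<close>)
  have limit_opt: "is_arg_min (psi K Q) (feasible l V0) xbar" if lim: "limit_point_at_0 x xbar" for xbar
  proof -
    obtain e where e: "\<And>k::nat. 0 < e k" "e \<longlonglongrightarrow> 0" "(\<lambda>k. x (e k)) \<longlonglongrightarrow> xbar"
      using lim by (auto simp: limit_point_at_0_def)
    have "psi K Q xbar \<le> psi K Q y" if "feasible l V0 y" for y
    proof (rule ereal_le_if_real_upper_bounds)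
      fix t
      assume "psi K Q y \<le> ereal t"
      then have "psi_eps K Q (e k) (x (e k)) \<le> ereal t" for k
        using x_le[OF e(1) that] order_trans by blast
      then show "psi K Q xbar \<le> ereal t"
        using limit_le[of e] e by blast
    qed
    with limit_feas[of e] e(1,3) show ?thesis
      by (auto simp: is_arg_min_def not_less)
  qed
  have subseq: "\<exists>xbar r. strict_mono r \<and> (\<lambda>k. x (e (r k))) \<longlonglongrightarrow> xbar \<and> (\<lambda>k. e (r k)) \<longlonglongrightarrow> 0"
    if e: "\<And>k. 0 < e k" "e \<longlonglongrightarrow> 0" for e :: "nat \<Rightarrow> real"
  proof -
    have "\<forall>k. x (e k) \<in> Collect (feasible l V0)" using x_feas e by simp
    then obtain xbar r where "strict_mono r" "((\<lambda>k. x (e k)) \<circ> r) \<longlonglongrightarrow> xbar"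
      using compact_feasible[OF l_pos, of V0] unfolding compact_def by meson
    with LIMSEQ_subseq_LIMSEQ[OF e(2)] show ?thesis by (auto simp: comp_def)
  qed
  have inv0: "(\<lambda>k. 1 / real (Suc k)) \<longlonglongrightarrow> 0"
    using LIMSEQ_inverse_real_of_nat by (simp add: inverse_eq_divide)
  \<comment> \<open>Any null sequence yields a limit point by compactness, and limit points are
    minimizers. Thus the convergence claim over all minimizers is not vacuous.\<close>
  have "\<exists>xstar. is_arg_min (psi K Q) (feasible l V0) xstar"
  proof -
    obtain xbar r where "(\<lambda>k. x (1 / real (Suc (r k)))) \<longlonglongrightarrow> xbar"
      "(\<lambda>k. 1 / real (Suc (r k))) \<longlonglongrightarrow> 0"
      using subseq[OF _ inv0] by auto
    then have "limit_point_at_0 x xbar"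
      unfolding limit_point_at_0_def by (intro exI[of _ "\<lambda>k. 1 / real (Suc (r k))"]) simp
    with limit_opt show ?thesis by blast
  qed
  moreover have "((\<lambda>\<epsilon>. psi_eps K Q \<epsilon> (x \<epsilon>)) \<longlongrightarrow> psi K Q xstar) (at_right 0)"
    if xs: "is_arg_min (psi K Q) (feasible l V0) xstar" for xstar
  proof (rule order_tendstoI)
    fix a
    assume "psi K Q xstar < a"
    \<comment> \<open>The upper half needs no limit: the optimal value of \<open>psi\<close> bounds
      the regularized one for every positive parameter.\<close>
    then have "psi_eps K Q \<epsilon> (x \<epsilon>) < a" if "\<epsilon> > 0" for \<epsilon>
      using x_le[OF that] xs by (meson is_arg_min_def le_less_trans)
    then show "\<forall>\<^sub>F \<epsilon> in at_right 0. psi_eps K Q \<epsilon> (x \<epsilon>) < a"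
      by (auto simp: eventually_at_filter)
  next
    fix a
    assume "a < psi K Q xstar"
    \<comment> \<open>The bound \<open>a\<close> may be minus infinity, whereas
      \<open>limit_le\<close> takes a real threshold; \<open>t\<close> still lies strictly below the
      optimal value.\<close>
    then obtain t where t: "a < ereal t" "ereal t < psi K Q xstar"
      using ereal_dense2 by blast
    show "\<forall>\<^sub>F \<epsilon> in at_right 0. a < psi_eps K Q \<epsilon> (x \<epsilon>)"
    proof (rule ccontr)
      assume "\<not> ?thesis"
      \<comment> \<open>If the lower half fails, bad parameters occur arbitrarily close to 0; a
        subsequence of their minimizers tends to a feasible point with value at most
        \<open>t\<close>, below the optimum.\<close>
      then have "\<exists>\<epsilon>>0. \<epsilon> < 1 / real (Suc k) \<and> psi_eps K Q \<epsilon> (x \<epsilon>) \<le> a" for k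
        unfolding eventually_at_right_field
        by (metis not_less of_nat_0_less_iff zero_less_Suc zero_less_divide_1_iff)
      then obtain e where e: "\<And>k. 0 < e k" "\<And>k. e k < 1 / real (Suc k)"
        "\<And>k. psi_eps K Q (e k) (x (e k)) \<le> a"
        by metis
      have "e \<longlonglongrightarrow> 0"
        by (rule tendsto_sandwich[OF _ _ tendsto_const inv0])
          (intro always_eventually allI less_imp_le e)+
      from subseq[OF e(1) this] obtain xbar r where
        r: "(\<lambda>k. x (e (r k))) \<longlonglongrightarrow> xbar" "(\<lambda>k. e (r k)) \<longlonglongrightarrow> 0"
        by blast
      have "psi K Q xbar \<le> ereal t"
      proof (rule limit_le[of "\<lambda>k. e (r k)"])
        show "psi_eps K Q (e (r k)) (x (e (r k))) \<le> ereal t" for k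
          using e(3)[of "r k"] t(1) by simp
      qed (use e(1) r in auto)
      moreover have "psi K Q xstar \<le> psi K Q xbar"
        using xs limit_feas[of "\<lambda>k. e (r k)"] e(1) r(1) by (auto simp: is_arg_min_def not_less)
      ultimately show False using t(2) by simp
    qed
  qed
  ultimately show ?thesis using limit_opt by blast
qed

end
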